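(* For any sequence $u$ with exactly $2$ distinct letters, either $\operatorname{Sat}(u,n)=\Theta(n)$ or $\operatorname{Sat}(u,n)=O(1)$.
   Context: Sequences are finite words over an alphabet; a sequence on a given alphabet takes its letters from that alphabet (not every letter is required to appear). Two sequences are isomorphic if one is obtained from the other by a one-to-one renaming of letters. A sequence contains a copy of $u$ if some (not necessarily contiguous) subsequence of it is isomorphic to $u$; otherwise it is $u$-free. A sequence is $2$-sparse if no two adjacent letters are equal. For a sequence $u$ with exactly $2$ distinct letters, a sequence $s$ on a given alphabet is $u$-saturated if $s$ is $2$-sparse, $u$-free, and inserting any letter of the alphabet at any position of $s$ (including the beginning or the end) violates $2$-sparsity or creates a copy of $u$. $\operatorname{Sat}(u,n)$ is the minimum possible length of a $u$-saturated sequence on an alphabet of size $n$. Asymptotic notation is for fixed $u$ as $n\to\infty$. *)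

theory Defs
  imports Complex_Main "HOL-Library.Sublist" "HOL-Library.Landau_Symbols"
begin

definition isomorphic_seq :: "'a list \<Rightarrow> 'b list \<Rightarrow> bool" where
  "isomorphic_seq u v \<longleftrightarrow> (\<exists>f. inj_on f (set u) \<and> v = map f u)"

definition contains_copy :: "'a list \<Rightarrow> 'b list \<Rightarrow> bool" where
  "contains_copy u s \<longleftrightarrow> (\<exists>v. subseq v s \<and> isomorphic_seq u v)"

text \<open>2-sparsity is \<^const>\<open>distinct_adj\<close>. The decompositions \<open>s = xs @ ys\<close> range over all
  insertion positions, including both ends.\<close>

definition saturated :: "'a list \<Rightarrow> 'b set \<Rightarrow> 'b list \<Rightarrow> bool" where
  "saturated u A s \<longleftrightarrow>
     set s \<subseteq> A \<and> distinct_adj s \<and> \<not> contains_copy u s \<and>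
     (\<forall>a\<in>A. \<forall>xs ys. s = xs @ ys \<longrightarrow>
        \<not> distinct_adj (xs @ [a] @ ys) \<or> contains_copy u (xs @ [a] @ ys))"

text \<open>The alphabets are taken among the sets of natural numbers; the letters of \<open>u\<close> may have any
  type. The infimum is an attained minimum whenever \<open>u\<close> has exactly two letters, by
  \<open>saturated_exists\<close> below.\<close>

definition Sat :: "'a list \<Rightarrow> nat \<Rightarrow> nat" where
  "Sat u n = Inf {length s | (A :: nat set) s. finite A \<and> card A = n \<and> saturated u A s}"

fun pair_up :: "'b list \<Rightarrow> ('b \<times> 'b) list" where
  "pair_up (x # y # s) = (x, y) # pair_up s"
| "pair_up _ = []"

definition flatten_pairs :: "('b \<times> 'b) list \<Rightarrow> 'b list" where
  "flatten_pairs ps = concat (map (\<lambda>(a, b). [a, b]) ps)"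

lemma length_pair_up: "length (pair_up s) = length s div 2"
  by (induction s rule: pair_up.induct) auto

lemma subseq_flatten_pair_up: "subseq (flatten_pairs (pair_up s)) s"
  by (induction s rule: pair_up.induct) (auto simp: flatten_pairs_def)

lemma set_pair_up: "distinct_adj s \<Longrightarrow> p \<in> set (pair_up s) \<Longrightarrow>
    fst p \<in> set s \<and> snd p \<in> set s \<and> fst p \<noteq> snd p"
  by (induction s rule: pair_up.induct) (auto simp: distinct_adj_Cons split: list.splits)

lemma subseq_flatten_pairs: "subseq ps qs \<Longrightarrow> subseq (flatten_pairs ps) (flatten_pairs qs)"
  by (induction rule: list_emb.induct) (auto simp: flatten_pairs_def split: prod.splits)

lemma subseq_flatten_replicate:
  "f ` set u \<subseteq> {a, b} \<Longrightarrow> subseq (map f u) (flatten_pairs (replicate (length u) (a, b)))"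
  by (induction u) (auto simp: flatten_pairs_def)

lemma long_contains_copy:
  fixes u :: "'a list" and s :: "'b list"
  assumes u: "card (set u) = 2" and A: "finite A" "set s \<subseteq> A" and s: "distinct_adj s"
    and len: "length s div 2 > card (A \<times> A) * length u"
  shows "contains_copy u s"
proof -
  let ?ps = "pair_up s"
  have sub: "set ?ps \<subseteq> A \<times> A"
    using set_pair_up[OF s] A(2) by fastforce
  have "\<exists>p\<in>set ?ps. count_list ?ps p > length u"
  proof (rule ccontr)
    assume "\<not> ?thesis"
    hence "(\<Sum>p\<in>set ?ps. count_list ?ps p) \<le> (\<Sum>p\<in>set ?ps. length u)"
      by (intro sum_mono) (auto simp: not_less)
    also have "\<dots> = card (set ?ps) * length u" by simp
    also have "\<dots> \<le> card (A \<times> A) * length u"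
      using card_mono[OF _ sub] A(1) by simp
    finally have "length ?ps \<le> card (A \<times> A) * length u"
      by (simp add: sum_count_set)
    thus False using len by (simp add: length_pair_up)
  qed
  then obtain p where p: "p \<in> set ?ps" "count_list ?ps p > length u" by blast
  obtain a b where ab: "p = (a, b)" by (cases p)
  have "a \<noteq> b" using set_pair_up[OF s p(1)] ab by simp
  obtain x y where xy: "set u = {x, y}" "x \<noteq> y" using u by (auto simp: card_2_iff)
  define f where "f = (\<lambda>z. if z = x then a else b)"
  have "filter ((=) p) qs = replicate (count_list qs p) p" for qs
    by (induction qs) auto
  hence "subseq (replicate (count_list ?ps p) p) ?ps" by (metis subseq_filter_left)
  moreover have "replicate (count_list ?ps p) p =
      replicate (count_list ?ps p - length u) p @ replicate (length u) p"
    using p(2) by (simp flip: replicate_add)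
  hence "subseq (replicate (length u) p) (replicate (count_list ?ps p) p)"
    by (metis list_emb_append2 subseq_order.order_refl)
  ultimately have "subseq (replicate (length u) p) ?ps" by (metis subseq_order.order_trans)
  moreover have "subseq (map f u) (flatten_pairs (replicate (length u) p))"
    unfolding ab by (rule subseq_flatten_replicate) (auto simp: f_def)
  ultimately have "subseq (map f u) s"
    by (meson subseq_flatten_pairs subseq_flatten_pair_up subseq_order.order_trans)
  moreover have "inj_on f (set u)" using xy \<open>a \<noteq> b\<close> by (auto simp: f_def inj_on_def)
  ultimately show ?thesis by (auto simp: contains_copy_def isomorphic_seq_def)
qed

lemma saturated_exists:
  fixes u :: "'a list" and A :: "'b set"
  assumes u: "card (set u) = 2" and A: "finite A"
  shows "\<exists>s. saturated u A s"
proof -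
  let ?P = "\<lambda>s. set s \<subseteq> A \<and> distinct_adj s \<and> \<not> contains_copy u s"
  have "u \<noteq> []" using u by auto
  hence "?P []" by (auto simp: contains_copy_def isomorphic_seq_def)
  moreover have "length s < 2 * (card (A \<times> A) * length u) + 2" if "?P s" for s
  proof -
    have "length s div 2 \<le> card (A \<times> A) * length u"
      using long_contains_copy[OF u A, of s] that by (meson not_less)
    thus ?thesis by linarith
  qed
  ultimately obtain s where s: "?P s" "\<And>t. ?P t \<Longrightarrow> length t \<le> length s"
    using ex_has_greatest_nat[of ?P "[]" length "2 * (card (A \<times> A) * length u) + 2"] by metis
  have "\<not> distinct_adj (xs @ [a] @ ys) \<or> contains_copy u (xs @ [a] @ ys)"
    if "a \<in> A" "s = xs @ ys" for a xs ys
    using s(1) s(2)[of "xs @ [a] @ ys"] that by auto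
  hence "saturated u A s"
    unfolding saturated_def using s(1) by blast
  thus ?thesis ..
qed

end

theory Submission
  imports Defs
begin

text \<open>
  Suppose that a saturated word misses a letter \<open>x\<close> of its alphabet. Inserting \<open>x\<close> creates a copy
  of \<open>u\<close> at every position, and a letter from outside the alphabet behaves just like \<open>x\<close>. Hence
  the same word is saturated over every larger alphabet, and the saturation function is bounded
  (\<open>Sat_bounded_if_small\<close>). If this never happens, every saturated word uses all its letters, so
  its length is at least \<open>n\<close>. The dichotomy therefore reduces to the upper bound \<open>O(n)\<close> for every
  \<open>u\<close> with two letters (\<open>Sat_linear\<close>), although the longest \<open>u\<close>-free words may well be
  superlinear.

  The upper bound comes from a skeleton: a 2-sparse \<open>u\<close>-free word of linear length such that, at
  every position, all but a bounded number of letters create a copy of \<open>u\<close> when inserted. Extend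
  the skeleton to a maximal 2-sparse \<open>u\<close>-free word, which is then saturated. Between two
  consecutive skeleton letters the extension uses boundedly many letters, so it has bounded length
  there, and its total length is linear (\<open>saturated_over_skeleton\<close>).

  Skeletons depend on the ends of \<open>u\<close>, over the letters \<open>a\<close> and \<open>b\<close>.

  If \<open>u\<close> begins and ends with \<open>a\<close>, let \<open>M\<close> be least such that \<open>u\<close> is a subsequence of the
  alternation \<open>(ab)\<^sup>M a\<close>. The skeleton is a braid, in which each letter lives in \<open>M\<close> consecutive
  rounds. A copy of \<open>u\<close> would have to fit into the rounds of the letter that plays \<open>a\<close>, where it
  finds only an alternation that is one period too short. Consecutive letters \<open>x\<close>, \<open>y\<close> alternate
  as \<open>(xy)\<^sup>M\<close>, so one more \<open>x\<close> after it or one more \<open>y\<close> before it completes a copy.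

  If \<open>u = a\<^sup>p\<^sup>+\<^sup>1 v b\<^sup>q\<^sup>+\<^sup>1\<close> where \<open>v\<close> begins with \<open>b\<close> and ends with \<open>a\<close>, let \<open>k\<close> be least such that
  \<open>v\<close> is a subsequence of \<open>(ba)\<^sup>k\<close>. A distinguished letter \<open>c\<close>, the hub, alternates \<open>k\<close> times with
  each other letter in turn; this is preceded by \<open>p\<close> and followed by \<open>q\<close> further occurrences of each
  other letter. These are one too few for the outer runs of \<open>u\<close>, so in a copy of \<open>u\<close> the
  middle part must supply \<open>v\<close> and a letter of each outer run, for which it is one period too
  short. One additional occurrence of a letter
  completes the first or the last run, and the middle part then accommodates the rest.

  In the remaining case \<open>u = a\<^sup>p b\<^sup>q\<close>, already all 2-sparse \<open>u\<close>-free words have linear length.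
\<close>

section \<open>Saturation numbers and the dichotomy\<close>

lemma Sat_le:
  assumes "finite (A :: nat set)" "saturated u A s"
  shows "Sat u (card A) \<le> length s"
  unfolding Sat_def by (rule cInf_lower) (use assms in auto)

lemma Sat_attained:
  fixes u :: "'a list"
  assumes "card (set u) = 2"
  obtains A :: "nat set" and s
  where "finite A" "card A = n" "saturated u A s" "length s = Sat u n"
proof -
  let ?S = "{length s | (A :: nat set) s. finite A \<and> card A = n \<and> saturated u A s}"
  obtain s :: "nat list" where "saturated u {..<n} s"
    using saturated_exists[OF assms, of "{..<n}"] by auto
  hence "length s \<in> ?S" by force
  hence "Sat u n \<in> ?S" unfolding Sat_def by (intro Inf_nat_def1) blast
  thus thesis using that by auto
qed

lemma contains_copy_mono:
  assumes "contains_copy u s" "subseq s t"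
  shows "contains_copy u t"
  using assms subseq_order.order_trans unfolding contains_copy_def by blast

lemma contains_copy_map:
  assumes "contains_copy u s" "inj_on f (set s)"
  shows "contains_copy u (map f s)"
proof -
  obtain g where g: "inj_on g (set u)" "subseq (map g u) s"
    using assms(1) by (auto simp: contains_copy_def isomorphic_seq_def)
  have "set (map g u) \<subseteq> set s"
    using list_emb_set[OF g(2)] by blast
  hence "inj_on (f \<circ> g) (set u)"
    by (intro comp_inj_on g(1)) (auto intro: inj_on_subset[OF assms(2)])
  moreover have "subseq (map (f \<circ> g) u) (map f s)"
    using subseq_map[OF g(2), of f] by simp
  ultimately show ?thesis by (auto simp: contains_copy_def isomorphic_seq_def)
qed

text \<open>
  Renaming \<open>x\<close> to a letter outside the alphabet turns the copy of \<open>u\<close> created by inserting \<open>x\<close> into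
  one created by inserting the new letter. As \<open>x\<close> is absent from the word, no insertion of \<open>x\<close>
  violates sparsity, so a copy really is created everywhere.
\<close>

lemma saturated_superset:
  assumes s: "saturated u A s" and x: "x \<in> A" "x \<notin> set s" and "A \<subseteq> B"
  shows "saturated u B s"
proof -
  have "contains_copy u (xs @ [z] @ ys)" if z: "z \<notin> A" and split: "s = xs @ ys" for z xs ys
  proof -
    have x_new: "x \<notin> set xs" "x \<notin> set ys" and z_new: "z \<notin> set xs" "z \<notin> set ys"
      using x(2) z s split by (auto simp: saturated_def)
    have "distinct_adj (xs @ [x] @ ys)"
      using s split x_new
      by (auto simp: saturated_def distinct_adj_append_iff distinct_adj_Cons
               dest: last_in_set hd_in_set)
    hence "contains_copy u (xs @ [x] @ ys)"
      using s x(1) split by (auto simp: saturated_def)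
    hence "contains_copy u (map (id(x := z)) (xs @ [x] @ ys))"
      by (rule contains_copy_map) (use x_new z_new in \<open>auto simp: inj_on_def\<close>)
    moreover have "map (id(x := z)) xs = xs" "map (id(x := z)) ys = ys"
      using x_new by (auto intro!: map_idI)
    ultimately show ?thesis by simp
  qed
  thus ?thesis
    using s \<open>A \<subseteq> B\<close> unfolding saturated_def by blast
qed

lemma Sat_bounded_if_small:
  fixes u :: "'a list"
  assumes u: "card (set u) = 2" and small: "Sat u n < n"
  shows "(\<lambda>n. real (Sat u n)) \<in> O(\<lambda>_. 1)"
proof -
  obtain A :: "nat set" and s where A: "finite A" "card A = n" "saturated u A s"
    and len: "length s = Sat u n"
    using Sat_attained[OF u] by metis
  \<comment> \<open>A word shorter than the size of its alphabet misses a letter.\<close>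
  have "card (set s) < card A"
    using card_length[of s] len small A(2) by linarith
  then obtain x where x: "x \<in> A" "x \<notin> set s"
    by (metis card_mono finite_set not_less subsetI)
  have "Sat u m \<le> Sat u n" if "m \<ge> n" for m
  proof -
    have "infinite (UNIV - A)"
      by (intro Diff_infinite_finite A(1) infinite_UNIV_nat)
    then obtain D where D: "D \<subseteq> UNIV - A" "finite D" "card D = m - n"
      using infinite_arbitrarily_large by metis
    hence "card (A \<union> D) = m"
      using A that by (subst card_Un_disjoint) auto
    moreover have "saturated u (A \<union> D) s"
      by (rule saturated_superset[OF A(3) x]) auto
    ultimately show ?thesis
      using Sat_le[of "A \<union> D" u s] A(1) D(2) len by simp
  qed
  thus ?thesis
    by (intro bigoI[of _ "real (Sat u n)"] eventually_mono[OF eventually_ge_at_top[of n]]) auto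
qed

section \<open>Linear upper bounds from skeletons\<close>

text \<open>
  A superword of \<open>xs\<close> is \<open>xs\<close> together with one factor in each of its \<open>length xs + 1\<close> gaps.
\<close>

lemma length_le_gaps:
  assumes "subseq xs s"
    and "\<And>w p q ys zs. s = p @ w @ q \<Longrightarrow> xs = ys @ zs \<Longrightarrow> subseq ys p \<Longrightarrow> subseq zs q
           \<Longrightarrow> length w \<le> B"
  shows "length s \<le> length xs + (length xs + 1) * B"
  using assms
proof (induction xs arbitrary: s)
  case Nil
  show ?case using Nil(2)[of "[]" s "[]" "[]" "[]"] by simp
next
  case (Cons x xs)
  obtain p s' where s: "s = p @ x # s'" "subseq xs s'"
    using list_emb_ConsD[OF Cons.prems(1)] by blast
  have "length p \<le> B"
    by (rule Cons.prems(2)[of "[]" _ "x # s'" "[]" "x # xs"]) (use s in auto)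
  moreover have "length s' \<le> length xs + (length xs + 1) * B"
  proof (rule Cons.IH[OF s(2)])
    fix w p' q ys zs
    assume "s' = p' @ w @ q" "xs = ys @ zs" "subseq ys p'" "subseq zs q"
    thus "length w \<le> B"
      by (intro Cons.prems(2)[of "p @ x # p'" w q "x # ys" zs]) (use s in auto)
  qed
  ultimately show ?case using s by simp
qed

text \<open>
  The saturated word is a longest 2-sparse \<open>u\<close>-free superword of the skeleton \<open>t\<close>. A factor lying in
  one gap of \<open>t\<close> consists of letters whose single insertion into this gap creates no copy of \<open>u\<close>;
  there are at most \<open>K\<close> of them, and a sparse \<open>u\<close>-free word over \<open>K\<close> letters has bounded length.
\<close>

lemma saturated_over_skeleton:
  fixes u :: "'a list" and A :: "'b set"
  assumes u: "card (set u) = 2" and A: "finite A"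
    and t: "set t \<subseteq> A" "distinct_adj t" "\<not> contains_copy u t"
    and free: "\<And>xs ys. t = xs @ ys \<Longrightarrow>
                 card {a \<in> A. \<not> contains_copy u (xs @ [a] @ ys)} \<le> K"
  obtains s where "saturated u A s"
    "length s \<le> length t + (length t + 1) * (2 * (K * K * length u) + 1)"
proof -
  let ?P = "\<lambda>s. subseq t s \<and> set s \<subseteq> A \<and> distinct_adj s \<and> \<not> contains_copy u s"
  have len: "length s \<le> length t + (length t + 1) * (2 * (K * K * length u) + 1)" if s: "?P s" for s
  proof (rule length_le_gaps)
    show "subseq t s" using s by simp
  next
    fix w p q ys zs
    assume w: "s = p @ w @ q" and t_split: "t = ys @ zs" "subseq ys p" "subseq zs q"
    define F where "F = {a \<in> A. \<not> contains_copy u (ys @ [a] @ zs)}"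
    have F: "finite F" "card F \<le> K" using A free[OF t_split(1)] by (auto simp: F_def)
    have "set w \<subseteq> F"
    proof
      fix a assume a: "a \<in> set w"
      have "subseq [a] w" using a by (simp add: subseq_singleton_left)
      hence "subseq (ys @ [a] @ zs) s"
        unfolding w by (intro list_emb_append_mono t_split(2,3))
      thus "a \<in> F" using s a w contains_copy_mono by (auto simp: F_def)
    qed
    moreover have "distinct_adj w" "\<not> contains_copy u w"
      using s w contains_copy_mono[of u w s]
      by (auto simp: subseq_drop_many subseq_rev_drop_many)
    ultimately have "length w div 2 \<le> card (F \<times> F) * length u"
      using long_contains_copy[OF u F(1), of w] not_less by blast
    also have "\<dots> \<le> K * K * length u"
      using F(2) by (simp add: card_cartesian_product mult_le_mono)
    finally show "length w \<le> 2 * (K * K * length u) + 1" by linarith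
  qed
  have "?P t" using t by simp
  moreover have "\<forall>s. ?P s \<longrightarrow> length s < length t + (length t + 1) * (2 * (K * K * length u) + 1) + 1"
    using len by (auto simp: less_Suc_eq_le)
  ultimately have "\<exists>s. ?P s \<and> (\<forall>s'. ?P s' \<longrightarrow> length s' \<le> length s)"
    by (rule ex_has_greatest_nat)
  then obtain s where s: "?P s" "\<And>s'. ?P s' \<Longrightarrow> length s' \<le> length s" by blast
  have "\<not> distinct_adj (xs @ [a] @ ys) \<or> contains_copy u (xs @ [a] @ ys)"
    if "a \<in> A" "s = xs @ ys" for a xs ys
  proof -
    have "subseq (xs @ ys) (xs @ [a] @ ys)" by (intro list_emb_append_mono) auto
    hence "subseq t (xs @ [a] @ ys)" using s(1) that(2) subseq_order.order_trans by blast
    thus ?thesis using s(1) s(2)[of "xs @ [a] @ ys"] that by auto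
  qed
  hence "saturated u A s" using s(1) by (simp add: saturated_def)
  thus thesis using that len[OF s(1)] by blast
qed

lemma Sat_linear_if_skeletons:
  fixes u :: "'a list"
  assumes u: "card (set u) = 2"
    and skel: "\<And>n. n \<ge> N \<Longrightarrow> \<exists>(A :: nat set) t. finite A \<and> card A = n \<and> set t \<subseteq> A \<and>
      distinct_adj t \<and> \<not> contains_copy u t \<and> length t \<le> D * n \<and>
      (\<forall>xs ys. t = xs @ ys \<longrightarrow> card {a \<in> A. \<not> contains_copy u (xs @ [a] @ ys)} \<le> K)"
  shows "(\<lambda>n. real (Sat u n)) \<in> O(\<lambda>n. real n)"
proof -
  define B where "B = 2 * (K * K * length u) + 1"
  have "Sat u n \<le> (D + (D + 1) * B) * n" if n: "n \<ge> max N 1" for n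
  proof -
    obtain A :: "nat set" and t where A: "finite A" "card A = n"
      and t: "set t \<subseteq> A" "distinct_adj t" "\<not> contains_copy u t" "length t \<le> D * n"
      and free: "\<And>xs ys. t = xs @ ys \<Longrightarrow> card {a \<in> A. \<not> contains_copy u (xs @ [a] @ ys)} \<le> K"
      using skel[of n] n by auto
    obtain s where s: "saturated u A s" "length s \<le> length t + (length t + 1) * B"
      unfolding B_def by (rule saturated_over_skeleton[OF u A(1) t(1-3) free])
    have "Sat u n \<le> length s" using Sat_le[OF A(1) s(1)] A(2) by simp
    also have "\<dots> \<le> D * n + (D * n + n) * B"
      using s(2) t(4) n by (smt (verit, best) add_mono max.boundedE mult_le_mono1 order_trans)
    also have "\<dots> = (D + (D + 1) * B) * n" by (simp add: algebra_simps)
    finally show ?thesis .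
  qed
  hence "\<forall>\<^sub>F n in sequentially. Sat u n \<le> (D + (D + 1) * B) * n"
    unfolding eventually_sequentially by blast
  hence "\<forall>\<^sub>F n in sequentially. norm (real (Sat u n)) \<le> real (D + (D + 1) * B) * norm (real n)"
    by (rule eventually_mono) (metis norm_of_nat of_nat_le_iff of_nat_mult)
  thus ?thesis by (rule bigoI)
qed

section \<open>Alternations and subsequences\<close>

definition alternation :: "'b \<Rightarrow> 'b \<Rightarrow> nat \<Rightarrow> 'b list" where
  "alternation x y m = concat (replicate m [x, y])"

lemma alternation_0 [simp]: "alternation x y 0 = []"
  by (simp add: alternation_def)

lemma alternation_Suc: "alternation x y (Suc m) = x # y # alternation x y m"
  by (simp add: alternation_def)

lemma alternation_snoc: "alternation x y m @ [x] = x # alternation y x m"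
  by (induction m) (auto simp: alternation_Suc)

lemma alternation_Suc_snoc: "alternation x y (Suc m) = alternation x y m @ [x, y]"
proof -
  have "alternation x y (Suc m) = x # (y # alternation x y m)" by (simp add: alternation_Suc)
  also have "\<dots> = (x # alternation y x m) @ [y]" by (simp flip: alternation_snoc)
  finally show ?thesis by (simp flip: alternation_snoc)
qed

lemma map_alternation: "map f (alternation x y m) = alternation (f x) (f y) m"
  by (induction m) (auto simp: alternation_Suc)

lemma set_alternation: "set (alternation x y m) \<subseteq> {x, y}"
  by (auto simp: alternation_def)

lemma subseq_alternation_length:
  "set w \<subseteq> {x, y} \<Longrightarrow> subseq w (alternation x y (length w))"
  by (induction w) (auto simp: alternation_Suc)

lemma subseq_rev: "subseq xs ys \<Longrightarrow> subseq (rev xs) (rev ys)"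
  by (induction rule: list_emb.induct) (auto intro: list_emb_append_mono)

lemma subseq_concat_replicate:
  "(\<And>xs. xs \<in> set xss \<Longrightarrow> subseq xs v) \<Longrightarrow> length xss \<le> m \<Longrightarrow>
     subseq (concat xss) (concat (replicate m v))"
proof (induction xss arbitrary: m)
  case (Cons xs xss)
  then obtain m' where "m = Suc m'" "length xss \<le> m'" by (cases m) auto
  thus ?case using Cons by (auto intro: list_emb_append_mono)
qed simp

lemma subseq_concat_map_upt:
  assumes "a \<le> c" "d \<le> b"
  shows "subseq (concat (map f [c..<d])) (concat (map f [a..<b]))"
proof (cases "c \<le> d")
  case True
  hence "[a..<b] = [a..<c] @ [c..<d] @ [d..<b]"
    using assms by (metis le_trans upt_add_eq_append le_add_diff_inverse)
  thus ?thesis by (simp add: subseq_drop_many subseq_rev_drop_many)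
qed simp

lemma subseq_map_inj_on:
  assumes "subseq (map f xs) (map f ys)" "inj_on f A" "set xs \<subseteq> A" "set ys \<subseteq> A"
  shows "subseq xs ys"
proof -
  have "map (inv_into A f) (map f zs) = zs" if "set zs \<subseteq> A" for zs
    unfolding map_map by (rule map_idI) (use that assms(2) in auto)
  thus ?thesis using subseq_map[OF assms(1), of "inv_into A f"] assms(3,4) by metis
qed

text \<open>
  This and the next lemma localise a subsequence: a word that begins and ends with \<open>z\<close> embeds into the
  part of the host that contains the occurrences of \<open>z\<close>.
\<close>

lemma subseq_drop_prefix:
  assumes "subseq w (p @ m)" "w \<noteq> []" "hd w \<notin> set p"
  shows "subseq w m"
proof -
  obtain w1 w2 where w: "w = w1 @ w2" "subseq w1 p" "subseq w2 m"
    using assms(1) by (auto simp: subseq_append_iff)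
  have "w1 = []"
  proof (rule ccontr)
    assume "w1 \<noteq> []"
    hence "hd w \<in> set w1" using w(1) by simp
    thus False using list_emb_set[OF w(2)] assms(3) by blast
  qed
  thus ?thesis using w by simp
qed

lemma subseq_drop_suffix:
  assumes "subseq w (m @ q)" "w \<noteq> []" "last w \<notin> set q"
  shows "subseq w m"
  using subseq_drop_prefix[of "rev w" "rev q" "rev m"] subseq_rev[OF assms(1)] assms(2,3)
  by (metis hd_rev rev_append rev_is_Nil_conv rev_rev_ident set_rev subseq_rev)

text \<open>
  This is where a copy of \<open>u\<close> falls short by one period in the braids and hubs below: a word with
  equal ends cannot use the outermost foreign letter of an alternation of even length.
\<close>

lemma subseq_alternation_same_ends:
  assumes w: "w \<noteq> []" "hd w = z" "last w = z" and "z \<noteq> y"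
    and sub: "subseq w (alternation z y m) \<or> subseq w (alternation y z m)"
  shows "subseq w (alternation z y (m - 1) @ [z])"
proof (cases m)
  case 0
  thus ?thesis using w sub by auto
next
  case (Suc m')
  from sub show ?thesis
  proof
    assume "subseq w (alternation z y m)"
    hence "subseq w ((alternation z y m' @ [z]) @ [y])" by (simp add: Suc alternation_Suc_snoc)
    hence "subseq w (alternation z y m' @ [z])"
      by (rule subseq_drop_suffix) (use w \<open>z \<noteq> y\<close> in auto)
    thus ?thesis by (simp add: Suc)
  next
    assume "subseq w (alternation y z m)"
    hence "subseq w ([y] @ (z # alternation y z m'))" by (simp add: Suc alternation_Suc)
    hence "subseq w (z # alternation y z m')"
      by (rule subseq_drop_prefix) (use w \<open>z \<noteq> y\<close> in auto)
    thus ?thesis by (simp add: Suc alternation_snoc)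
  qed
qed

lemma contains_copyI: "inj_on f (set u) \<Longrightarrow> subseq (map f u) s \<Longrightarrow> contains_copy u s"
  by (auto simp: contains_copy_def isomorphic_seq_def)

lemma contains_copyE:
  assumes "contains_copy u s"
  obtains f where "inj_on f (set u)" "subseq (map f u) s"
  using assms by (auto simp: contains_copy_def isomorphic_seq_def)

section \<open>Words that begin and end with the same letter: braids\<close>

text \<open>
  Round \<open>t\<close> contains the letters \<open>t, \<dots>, t + M - 1\<close>, so the letter \<open>z\<close> occurs in the rounds
  \<open>z - M + 1, \<dots>, z\<close>. It enters and leaves one round before \<open>z + 1\<close>; as rounds list their letters in
  decreasing order, the two letters form exactly the alternation \<open>(z (z + 1))\<^sup>M\<close>. Increasing order
  would instead produce \<open>zz\<close> at its beginning.
\<close>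

definition braid :: "nat \<Rightarrow> nat \<Rightarrow> nat list" where
  "braid M N = concat (map (\<lambda>t. rev [t..<t + M]) [0..<N])"

lemma distinct_adj_braid:
  assumes "M > 0"
  shows "distinct_adj (braid M N)"
proof (induction N)
  case (Suc N)
  have "last (braid M N) \<noteq> N + M - 1" if "N > 0"
  proof -
    obtain N' where "N = Suc N'" using \<open>N > 0\<close> by (cases N) auto
    thus ?thesis using assms by (simp add: braid_def last_rev)
  qed
  moreover have "braid M N = []" if "N = 0" using that by (simp add: braid_def)
  moreover have "distinct_adj [N..<N + M]"
    by (simp add: distinct_adj_conv_nth)
  ultimately show ?case using assms Suc
    by (auto simp: braid_def distinct_adj_append_iff hd_rev)
qed (simp add: braid_def)

lemma filter_pair_rev_upt:
  assumes "x < y"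
  shows "subseq (filter (\<lambda>v. v \<in> {x, y}) (rev [i..<j])) [y, x]"
proof -
  have "subseq (filter (\<lambda>v. v \<in> {x, y}) [i..<j]) [x, y]"
    by (rule sorted_subset_imp_subseq)
      (use assms in \<open>auto intro: sorted_wrt_filter\<close>)
  thus ?thesis by (metis rev_filter rev.simps append_Cons append_Nil subseq_rev)
qed

text \<open>
  All of \<open>w\<close> embeds into the at most \<open>M\<close> rounds containing \<open>z\<close>. Each of them contributes at most one
  \<open>z\<close> and one \<open>y\<close>, always in the same order, so these rounds provide an alternation with \<open>M\<close> periods.
\<close>

lemma braid_same_ends:
  assumes w: "w \<noteq> []" "hd w = z" "last w = z" "set w \<subseteq> {z, y}" and "z \<noteq> y"
    and sub: "subseq w (braid M N)"
  shows "subseq w (alternation z y (M - 1) @ [z])"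
proof -
  define R where "R = (\<lambda>t. rev [t..<t + M])"
  define l h where "l = min N (Suc z - M)" and "h = min N (Suc z)"
  have "[0..<N] = [0..<l] @ [l..<h] @ [h..<N]"
    using upt_add_eq_append[of 0 l "N - l"] upt_add_eq_append[of l h "N - h"]
    by (simp add: l_def h_def)
  hence "subseq w (concat (map R [0..<l]) @ concat (map R [l..<h]) @ concat (map R [h..<N]))"
    using sub by (simp add: braid_def R_def)
  hence "subseq w (concat (map R [l..<h]) @ concat (map R [h..<N]))"
    by (rule subseq_drop_prefix) (use w in \<open>auto simp: R_def l_def\<close>)
  hence "subseq w (concat (map R [l..<h]))"
    by (rule subseq_drop_suffix) (use w in \<open>auto simp: R_def h_def\<close>)
  hence "subseq (filter (\<lambda>v. v \<in> {z, y}) w)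
           (filter (\<lambda>v. v \<in> {z, y}) (concat (map R [l..<h])))" (is "subseq _ ?C")
    by (rule subseq_filter)
  moreover have "filter (\<lambda>v. v \<in> {z, y}) w = w"
    using w(4) by (auto intro: filter_True)
  ultimately have wC: "subseq w ?C" by simp
  have C: "subseq ?C (alternation (max z y) (min z y) M)"
    unfolding filter_concat alternation_def
  proof (rule subseq_concat_replicate)
    fix xs assume "xs \<in> set (map (filter (\<lambda>v. v \<in> {z, y})) (map R [l..<h]))"
    then obtain t where "xs = filter (\<lambda>v. v \<in> {z, y}) (rev [t..<t + M])"
      by (auto simp: R_def)
    moreover have "{z, y} = {min z y, max z y}"
      by (auto simp: min_def max_def)
    ultimately show "subseq xs [max z y, min z y]"
      using filter_pair_rev_upt[of "min z y" "max z y"] \<open>z \<noteq> y\<close> by simp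
  qed (auto simp: l_def h_def)
  have "subseq w (alternation z y M) \<or> subseq w (alternation y z M)"
    using subseq_order.order_trans[OF wC C] by (auto simp: max_def min_def split: if_splits)
  thus ?thesis by (rule subseq_alternation_same_ends[OF w(1-3) \<open>z \<noteq> y\<close>])
qed

text \<open>
  The rounds \<open>s, \<dots>, z + 1\<close> supply \<open>z\<close> alone, then \<open>z + 1\<close> before \<open>z\<close> in each of \<open>M - 1\<close> rounds, and
  finally \<open>z + 1\<close> alone.
\<close>

lemma alternation_in_rounds:
  assumes "M > 0" "s + M = Suc z"
  shows "subseq (alternation z (Suc z) M) (concat (map (\<lambda>t. rev [t..<t + M]) [s..<Suc (Suc z)]))"
proof -
  define R where "R = (\<lambda>t. rev [t..<t + M])"
  have pair: "subseq [Suc z, z] (R t)" if "t \<le> z" "Suc z < t + M" for t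
  proof -
    have "subseq [z, Suc z] [t..<t + M]"
      by (rule sorted_subset_imp_subseq) (use that in auto)
    from subseq_rev[OF this] show ?thesis by (simp add: R_def)
  qed
  have "subseq (z # alternation (Suc z) z m) (concat (map R [s..<s + Suc m]))" if "m < M" for m
    using that
  proof (induction m)
    case 0
    thus ?case using assms by (auto simp: R_def subseq_singleton_left)
  next
    case (Suc m)
    have "subseq ((z # alternation (Suc z) z m) @ [Suc z, z])
            (concat (map R [s..<s + Suc m]) @ R (s + Suc m))"
      by (intro list_emb_append_mono Suc.IH pair) (use Suc.prems assms in auto)
    thus ?case by (simp add: alternation_Suc_snoc)
  qed
  from this[of "M - 1"] have
    "subseq (z # alternation (Suc z) z (M - 1)) (concat (map R [s..<Suc z]))"
    using assms by simp
  moreover have "subseq [Suc z] (R (Suc z))"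
    using assms by (auto simp: R_def subseq_singleton_left)
  ultimately have "subseq ((z # alternation (Suc z) z (M - 1)) @ [Suc z])
      (concat (map R [s..<Suc z]) @ R (Suc z))"
    by (rule list_emb_append_mono)
  moreover have "(z # alternation (Suc z) z (M - 1)) @ [Suc z] = alternation z (Suc z) M"
    using assms(1) by (cases M) (simp_all add: alternation_Suc_snoc flip: alternation_snoc)
  moreover have "concat (map R [s..<Suc z]) @ R (Suc z) = concat (map R [s..<Suc (Suc z)])"
    using assms by simp
  ultimately show ?thesis by (simp only: R_def)
qed

lemma concat_map_upt_split:
  assumes "concat (map f [0..<N]) = xs @ ys" "N > 0"
  obtains t p q where "t < N" "f t = p @ q" "xs = concat (map f [0..<t]) @ p"
    "ys = q @ concat (map f [Suc t..<N])"
proof -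
  obtain xss p q yss where *: "map f [0..<N] = xss @ (p @ q) # yss"
    "xs = concat xss @ p" "ys = q @ concat yss"
    using concat_eq_appendD[OF assms(1)] assms(2) by auto
  define t where "t = length xss"
  have "length (map f [0..<N]) = length (xss @ (p @ q) # yss)" by (simp only: *)
  hence t: "t < N" by (simp add: t_def)
  have "xss = take t (map f [0..<N])" "yss = drop (Suc t) (map f [0..<N])"
    by (simp_all add: * t_def)
  hence "xss = map f [0..<t]" "yss = map f [Suc t..<N]"
    using t by (simp_all add: take_map drop_map)
  moreover have "f t = p @ q"
    using t arg_cong[OF *(1), of "\<lambda>zs. zs ! t"] by (simp add: t_def)
  ultimately show thesis using that t * by blast
qed

text \<open>
  If \<open>z\<close> is inserted well before its own rounds, it precedes the full alternation of \<open>z - 1\<close> and \<open>z\<close>;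
  if it is inserted well after them, it follows the full alternation of \<open>z\<close> and \<open>z + 1\<close>. The bounds
  on \<open>z\<close> exclude the letters near the ends of the braid, which occur in fewer than \<open>M\<close> rounds or have
  such a neighbour.
\<close>

lemma braid_insertion:
  assumes M: "M > 0" and z: "M \<le> z" "z < N"
    and xs: "xs = concat (map (\<lambda>t. rev [t..<t + M]) [0..<t]) @ p"
    and ys: "ys = q @ concat (map (\<lambda>t. rev [t..<t + M]) [Suc t..<N])"
    and far: "t + M < z \<or> Suc z < t"
  shows "\<exists>y. y \<noteq> z \<and> subseq (alternation z y M @ [z]) (xs @ [z] @ ys)"
  using far
proof
  define R where "R = (\<lambda>t. rev [t..<t + M])"
  assume t: "t + M < z"
  then obtain y where y: "z = Suc y" by (cases z) auto
  have "subseq (alternation y z M) (concat (map R [z - M..<Suc z]))"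
    using alternation_in_rounds[of M "z - M" y] M z y by (simp add: R_def)
  also have "subseq \<dots> (concat (map R [Suc t..<N]))"
    by (rule subseq_concat_map_upt) (use t z in auto)
  finally have "subseq ([] @ [z] @ alternation y z M) (xs @ [z] @ ys)"
    unfolding ys R_def by (intro list_emb_append_mono) auto
  thus ?thesis using y by (intro exI[of _ y]) (auto simp: alternation_snoc)
next
  define R where "R = (\<lambda>t. rev [t..<t + M])"
  assume t: "Suc z < t"
  have "subseq (alternation z (Suc z) M) (concat (map R [Suc z - M..<Suc (Suc z)]))"
    using alternation_in_rounds[of M "Suc z - M" z] M z by (simp add: R_def)
  also have "subseq \<dots> (concat (map R [0..<t]))"
    by (rule subseq_concat_map_upt) (use t in auto)
  finally have "subseq (alternation z (Suc z) M @ [z] @ []) (xs @ [z] @ ys)"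
    unfolding xs R_def by (intro list_emb_append_mono) auto
  thus ?thesis by (intro exI[of _ "Suc z"]) auto
qed

text \<open>
  Minimality of \<open>M\<close> makes the braid \<open>u\<close>-free, and the choice of \<open>M\<close> as sufficient makes every
  insertion far from a letter's own rounds create a copy. What remains insertable at a position in
  round \<open>t\<close> are the letters within distance about \<open>M\<close> of \<open>t\<close> and of the two ends of the alphabet.
\<close>

lemma Sat_linear_same_ends:
  fixes u :: "'a list"
  assumes u: "card (set u) = 2" and ends: "hd u = last u"
  shows "(\<lambda>n. real (Sat u n)) \<in> O(\<lambda>n. real n)"
proof -
  define a where "a = hd u"
  have "u \<noteq> []" using u by auto
  hence "a \<in> set u" by (simp add: a_def)
  then obtain b where ab: "set u = {a, b}" "a \<noteq> b"
    using u by (metis card_2_iff insert_commute insertE singletonD)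
  define M where "M = (LEAST m. subseq u (alternation a b m @ [a]))"
  have "subseq u (alternation a b (length u) @ [a])"
    using subseq_alternation_length[of u a b] ab(1) by (simp add: subseq_rev_drop_many)
  hence uM: "subseq u (alternation a b M @ [a])"
    unfolding M_def by (rule LeastI)
  have M: "M > 0"
  proof (rule ccontr)
    assume "\<not> M > 0"
    hence "set u \<subseteq> {a}" using uM list_emb_set[OF uM] by auto
    thus False using ab by auto
  qed
  have not_M1: "\<not> subseq u (alternation a b (M - 1) @ [a])"
    by (rule not_less_Least[of _ "\<lambda>m. subseq u (alternation a b m @ [a])", folded M_def])
      (use M in simp)
  have "\<exists>(A :: nat set) t. finite A \<and> card A = n \<and> set t \<subseteq> A \<and>
      distinct_adj t \<and> \<not> contains_copy u t \<and> length t \<le> M * n \<and>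
      (\<forall>xs ys. t = xs @ ys \<longrightarrow> card {a \<in> A. \<not> contains_copy u (xs @ [a] @ ys)} \<le> 3 * M + 2)"
    if n: "n \<ge> M" for n
  proof -
    define N where "N = Suc n - M"
    have N: "N > 0" "N + M = Suc n" using n by (auto simp: N_def)
    have letters: "set (braid M N) \<subseteq> {..<n}" using N by (auto simp: braid_def)
    have len: "length (braid M N) \<le> M * n"
    proof -
      have "length (braid M N) = N * M"
        by (simp add: braid_def length_concat o_def sum_list_triv)
      also have "\<dots> \<le> n * M" using N M by (intro mult_right_mono) auto
      finally show ?thesis by (simp add: mult.commute)
    qed
    have free: "\<not> contains_copy u (braid M N)"
    proof
      assume "contains_copy u (braid M N)"
      then obtain f where f: "inj_on f (set u)" "subseq (map f u) (braid M N)"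
        by (rule contains_copyE)
      have "subseq (map f u) (alternation (f a) (f b) (M - 1) @ [f a])"
      proof (rule braid_same_ends[OF _ _ _ _ _ f(2)])
        show "f a \<noteq> f b" using f(1) ab by (auto simp: inj_on_def)
      qed (use ab \<open>u \<noteq> []\<close> ends in \<open>auto simp: hd_map last_map a_def\<close>)
      hence "subseq (map f u) (map f (alternation a b (M - 1) @ [a]))"
        by (simp add: map_alternation)
      hence "subseq u (alternation a b (M - 1) @ [a])"
        by (rule subseq_map_inj_on[OF _ f(1)])
          (use ab set_alternation[of a b "M - 1"] in auto)
      thus False using not_M1 by simp
    qed
    have "card {z \<in> {..<n}. \<not> contains_copy u (xs @ [z] @ ys)} \<le> 3 * M + 2"
      if split: "braid M N = xs @ ys" for xs ys
    proof -
      obtain t p q where t: "t < N" and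
        xs: "xs = concat (map (\<lambda>t. rev [t..<t + M]) [0..<t]) @ p" and
        ys: "ys = q @ concat (map (\<lambda>t. rev [t..<t + M]) [Suc t..<N])"
        using concat_map_upt_split[OF split[unfolded braid_def] N(1)] by metis
      have copy: "contains_copy u (xs @ [z] @ ys)"
        if z: "M \<le> z" "z < N" and far: "t + M < z \<or> Suc z < t" for z
      proof -
        obtain y where y: "y \<noteq> z" "subseq (alternation z y M @ [z]) (xs @ [z] @ ys)"
          using braid_insertion[OF M z xs ys far] by blast
        define f where "f = (\<lambda>v. if v = a then z else y)"
        have "subseq (map f u) (map f (alternation a b M @ [a]))"
          by (rule subseq_map[OF uM])
        also have "\<dots> = alternation z y M @ [z]"
          using ab(2) by (simp add: map_alternation f_def)
        finally have "subseq (map f u) (xs @ [z] @ ys)"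
          using y(2) by (rule subseq_order.order_trans)
        moreover have "inj_on f (set u)"
          using ab y(1) by (auto simp: f_def inj_on_def)
        ultimately show ?thesis by (rule contains_copyI[rotated])
      qed
      have "{z \<in> {..<n}. \<not> contains_copy u (xs @ [z] @ ys)}
              \<subseteq> {..<M} \<union> {N..<n} \<union> {t - 1..t + M}"
      proof
        fix z assume z: "z \<in> {z \<in> {..<n}. \<not> contains_copy u (xs @ [z] @ ys)}"
        hence "\<not> (M \<le> z \<and> z < N \<and> (t + M < z \<or> Suc z < t))" using copy by blast
        thus "z \<in> {..<M} \<union> {N..<n} \<union> {t - 1..t + M}" using z by auto
      qed
      hence "card {z \<in> {..<n}. \<not> contains_copy u (xs @ [z] @ ys)}
              \<le> card ({..<M} \<union> {N..<n} \<union> {t - 1..t + M})"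
        by (intro card_mono) auto
      also have "\<dots> \<le> card {..<M} + card {N..<n} + card {t - 1..t + M}"
        by (meson add_mono_thms_linordered_semiring(3) card_Un_le order_trans)
      also have "\<dots> \<le> 3 * M + 2" using N by simp
      finally show ?thesis .
    qed
    thus ?thesis
      using letters len free distinct_adj_braid[OF M, of N]
      by (intro exI[of _ "{..<n}"] exI[of _ "braid M N"]) simp
  qed
  thus ?thesis by (rule Sat_linear_if_skeletons[OF u])
qed

section \<open>Words with different ends and at least four runs: hubs\<close>

lemma count_list_subseq: "subseq xs ys \<Longrightarrow> count_list xs z \<le> count_list ys z"
  by (induction rule: list_emb.induct) auto

lemma subseq_replicate_count:
  assumes "m \<le> count_list xs z"
  shows "subseq (replicate m z) xs"
proof -
  have "filter ((=) z) xs = replicate (count_list xs z) z" by (induction xs) auto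
  hence "subseq (replicate (count_list xs z) z) xs" by (metis subseq_filter_left)
  moreover have "replicate (count_list xs z) z = replicate m z @ replicate (count_list xs z - m) z"
    using assms by (simp flip: replicate_add)
  hence "subseq (replicate m z) (replicate (count_list xs z) z)"
    by (simp add: subseq_rev_drop_many)
  ultimately show ?thesis using subseq_order.order_trans by blast
qed

text \<open>
  This and the next lemma say why \<open>m\<close> occurrences of \<open>z\<close> before (or after) a word do not help to embed
  a run of \<open>m + 1\<close> letters \<open>z\<close>: at least one letter of the run has to be found inside the word.
\<close>

lemma subseq_skip_few_prefix:
  assumes "subseq (replicate (Suc m) z @ w) (xs @ ys)" "count_list xs z \<le> m"
  shows "subseq (z # w) ys"
proof -
  obtain w1 w2 where w: "replicate (Suc m) z @ w = w1 @ w2" "subseq w1 xs" "subseq w2 ys"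
    using assms(1) by (auto simp: subseq_append_iff)
  have "length w1 \<le> m"
  proof (rule ccontr)
    assume "\<not> length w1 \<le> m"
    hence "take (Suc m) w1 = take (Suc m) (w1 @ w2)" by simp
    also have "\<dots> = replicate (Suc m) z" by (simp flip: w(1))
    finally have "w1 = replicate (Suc m) z @ drop (Suc m) w1" by (metis append_take_drop_id)
    moreover have "count_list (replicate (Suc m) z) z = Suc m" by (induction m) auto
    ultimately have "count_list w1 z \<ge> Suc m"
      by (metis count_list_append le_add1)
    thus False using count_list_subseq[OF w(2), of z] assms(2) by simp
  qed
  have "w2 = drop (length w1) (replicate (Suc m) z @ w)" using w(1) by simp
  also have "\<dots> = replicate (Suc (m - length w1)) z @ w"
    using \<open>length w1 \<le> m\<close> by (simp add: Suc_diff_le del: replicate_Suc)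
  also have "\<dots> = replicate (m - length w1) z @ z # w"
    by (simp add: replicate_app_Cons_same)
  finally have "subseq (z # w) w2" by (simp add: subseq_drop_many)
  thus ?thesis using w(3) subseq_order.order_trans by blast
qed

lemma subseq_skip_few_suffix:
  assumes "subseq (w @ replicate (Suc m) z) (xs @ ys)" "count_list ys z \<le> m"
  shows "subseq (w @ [z]) xs"
proof -
  have "subseq (replicate (Suc m) z @ rev w) (rev ys @ rev xs)"
    using subseq_rev[OF assms(1)] by (simp add: replicate_append_same)
  hence "subseq (z # rev w) (rev xs)"
    by (rule subseq_skip_few_prefix) (use assms(2) in simp)
  from subseq_rev[OF this] show ?thesis by simp
qed

text \<open>
  The order of the letters in a sweep is irrelevant; what matters is that each occurs \<open>m\<close> times, and
  that the word is 2-sparse.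
\<close>

definition sweeps :: "nat \<Rightarrow> nat \<Rightarrow> nat list" where
  "sweeps m n = concat (replicate m [0..<n])"

text \<open>
  The hub is the letter \<open>c\<close>. Two other letters never interleave, whereas \<open>c\<close> occurs often both before
  and after the block of every other letter, except near the two ends.
\<close>

definition hub :: "nat \<Rightarrow> nat \<Rightarrow> nat \<Rightarrow> nat \<Rightarrow> nat list" where
  "hub c k l h = concat (map (\<lambda>i. alternation i c k) [l..<h])"

lemma count_sweeps: "count_list (sweeps m n) z = (if z < n then m else 0)"
proof -
  have "count_list [0..<n] z = (if z < n then 1 else 0)"
    by (induction n) auto
  thus ?thesis by (induction m) (auto simp: sweeps_def)
qed

lemma set_hub: "set (hub c k l h) \<subseteq> {l..<h} \<union> {c}"
  using set_alternation by (fastforce simp: hub_def)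

lemma distinct_adj_alternation: "x \<noteq> y \<Longrightarrow> distinct_adj (alternation x y m)"
proof (induction m)
  case (Suc m)
  thus ?case by (cases m) (auto simp: alternation_Suc distinct_adj_Cons)
qed simp

lemma distinct_adj_sweeps:
  assumes "n \<ge> 2"
  shows "distinct_adj (sweeps m n)"
proof (induction m)
  case (Suc m)
  have "distinct_adj [0..<n]" by (simp add: distinct_adj_conv_nth)
  moreover have "sweeps m n \<noteq> [] \<Longrightarrow> hd (sweeps m n) = 0"
    using assms by (cases m) (auto simp: sweeps_def hd_append)
  ultimately show ?case using Suc assms
    by (auto simp: sweeps_def distinct_adj_append_iff)
qed (simp add: sweeps_def)

lemma last_alternation: "m > 0 \<Longrightarrow> last (alternation x y m) = y"
  by (cases m) (auto simp: alternation_Suc_snoc)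

lemma hd_alternation: "m > 0 \<Longrightarrow> hd (alternation x y m) = x"
  by (cases m) (auto simp: alternation_Suc)

lemma alternation_eq_Nil_iff [simp]: "alternation x y m = [] \<longleftrightarrow> m = 0"
  by (cases m) (auto simp: alternation_Suc)

lemma length_alternation [simp]: "length (alternation x y m) = 2 * m"
  by (induction m) (auto simp: alternation_Suc)

lemma hub_Suc: "l \<le> h \<Longrightarrow> hub c k l (Suc h) = hub c k l h @ alternation h c k"
  by (simp add: hub_def)

lemma last_hub: "k > 0 \<Longrightarrow> l < h \<Longrightarrow> last (hub c k l h) = c"
  by (cases h) (auto simp: hub_Suc last_alternation)

lemma hd_hub: "k > 0 \<Longrightarrow> l < h \<Longrightarrow> hd (hub c k l h) = l"
  by (simp add: hub_def upt_conv_Cons hd_alternation)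

lemma distinct_adj_hub:
  assumes "k > 0" "n \<le> c"
  shows "distinct_adj (hub c k 0 n)"
  using assms(2)
proof (induction n)
  case (Suc n)
  have "n > 0 \<Longrightarrow> last (hub c k 0 n) = c" using assms(1) by (simp add: last_hub)
  moreover have "hub c k 0 0 = []" by (simp add: hub_def)
  ultimately show ?case using Suc assms(1)
    by (cases "n = 0") (auto simp: hub_Suc distinct_adj_append_iff distinct_adj_alternation hd_alternation)
qed (simp add: hub_def)

lemma hub_split:
  assumes "l \<le> z" "z < h"
  shows "hub c k l h = hub c k l z @ alternation z c k @ hub c k (Suc z) h"
proof -
  have "[l..<h] = [l..<z] @ z # [Suc z..<h]"
    using assms upt_add_eq_append[of l z "h - z"] by (simp add: upt_conv_Cons)
  thus ?thesis by (simp add: hub_def)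
qed

lemma subseq_replicate_hub: "k > 0 \<Longrightarrow> l + m \<le> h \<Longrightarrow> subseq (replicate m c) (hub c k l h)"
proof (induction m arbitrary: l)
  case (Suc m)
  have "subseq [c] (alternation l c k)"
    using Suc.prems(1) by (cases k) (auto simp: alternation_Suc)
  moreover have "subseq (replicate m c) (hub c k (Suc l) h)"
    using Suc by simp
  ultimately have "subseq ([c] @ replicate m c) (alternation l c k @ hub c k (Suc l) h)"
    by (rule list_emb_append_mono)
  also have "alternation l c k @ hub c k (Suc l) h = hub c k l h"
    using hub_split[of l l h c k] Suc.prems by (simp add: hub_def)
  finally show ?case by simp
qed simp

text \<open>
  Every block ends with \<open>c\<close>, so \<open>m\<close> blocks before and \<open>m'\<close> blocks after the block of \<open>z\<close> suffice.
\<close>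

lemma subseq_hub_around:
  assumes "k > 0" "l + m \<le> z" "z + m' < h"
  shows "subseq (replicate m c @ alternation z c k @ replicate m' c) (hub c k l h)"
  using hub_split[of l z h c k] assms
  by (auto intro!: list_emb_append_mono subseq_replicate_hub)

lemma hub_same_ends:
  assumes w: "w \<noteq> []" "hd w = z" "last w = z" and "z \<noteq> c"
    and sub: "subseq w (hub c k 0 n)"
  shows "subseq w (alternation z c k)"
proof -
  have "z \<in> set (hub c k 0 n)" using w(1,2) list_emb_set[OF sub] by (metis hd_in_set)
  hence "z < n" using set_hub[of c k 0 n] \<open>z \<noteq> c\<close> by auto
  hence "subseq w (hub c k 0 z @ alternation z c k @ hub c k (Suc z) n)"
    using sub hub_split[of 0 z n c k] by simp
  hence "subseq w (alternation z c k @ hub c k (Suc z) n)"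
    by (rule subseq_drop_prefix) (use w \<open>z \<noteq> c\<close> set_hub[of c k 0 z] in auto)
  thus ?thesis
    by (rule subseq_drop_suffix) (use w \<open>z \<noteq> c\<close> set_hub[of c k "Suc z" n] in auto)
qed

lemma set_outer_runs:
  "set v = {a, b} \<Longrightarrow> set (replicate (Suc p) a @ v @ replicate (Suc q) b) = {a, b}"
  unfolding set_append set_replicate_Suc by blast

text \<open>
  Since the sweeps contain each letter once too few for the outer runs, a copy forces
  \<open>f a # map f v @ [f b]\<close> into the hub part. If \<open>f a\<close> is not the hub, then \<open>f a # map f v\<close> begins and ends
  with \<open>f a\<close> and lies in the block of \<open>f a\<close>; otherwise \<open>map f v @ [f b]\<close> begins and ends with \<open>f b\<close> and
  lies in the block of \<open>f b\<close>. In both cases the end left over pushes the image of \<open>v\<close> into an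
  alternation with only \<open>k - 1\<close> periods. The hub \<open>c\<close> is the letter \<open>n\<close>.
\<close>

lemma copy_free_hub:
  assumes "a \<noteq> b" and v: "v \<noteq> []" "set v = {a, b}" "hd v = b" "last v = a"
    and min: "\<not> subseq v (alternation b a (k - 1))"
  shows "\<not> contains_copy (replicate (Suc p) a @ v @ replicate (Suc q) b)
           (sweeps p n @ hub n k 0 n @ sweeps q n)"
proof
  let ?u = "replicate (Suc p) a @ v @ replicate (Suc q) b"
  assume "contains_copy ?u (sweeps p n @ hub n k 0 n @ sweeps q n)"
  then obtain f where f: "inj_on f (set ?u)"
    "subseq (map f ?u) (sweeps p n @ hub n k 0 n @ sweeps q n)"
    by (rule contains_copyE)
  define x y w where "x = f a" and "y = f b" and "w = map f v"
  have set_u: "set ?u = {a, b}" by (rule set_outer_runs[OF v(2)])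
  have xy: "x \<noteq> y"
    using inj_on_eq_iff[OF f(1)[unfolded set_u], of a b] \<open>a \<noteq> b\<close> by (simp add: x_def y_def)
  have w: "w \<noteq> []" "set w = {x, y}" "hd w = y" "last w = x"
    using v by (simp_all add: w_def x_def y_def hd_map last_map)
  have not_w: "\<not> subseq w (alternation y x (k - 1))"
  proof
    assume "subseq w (alternation y x (k - 1))"
    hence "subseq (map f v) (map f (alternation b a (k - 1)))"
      by (simp add: map_alternation w_def x_def y_def)
    hence "subseq v (alternation b a (k - 1))"
      by (rule subseq_map_inj_on[OF _ f(1)[unfolded set_u]])
        (use v(2) set_alternation[of b a "k - 1"] in auto)
    thus False using min by simp
  qed
  have "subseq (replicate (Suc p) x @ (w @ replicate (Suc q) y))
          (sweeps p n @ hub n k 0 n @ sweeps q n)"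
    using f(2) by (simp add: x_def y_def w_def)
  hence "subseq (x # (w @ replicate (Suc q) y)) (hub n k 0 n @ sweeps q n)"
    by (rule subseq_skip_few_prefix) (simp add: count_sweeps)
  hence "subseq ((x # w) @ replicate (Suc q) y) (hub n k 0 n @ sweeps q n)" by simp
  hence "subseq ((x # w) @ [y]) (hub n k 0 n)"
    by (rule subseq_skip_few_suffix) (simp add: count_sweeps)
  hence xw: "subseq (x # w) (hub n k 0 n)" and wy: "subseq (w @ [y]) (hub n k 0 n)"
    by (auto dest: subseq_Cons' intro: subseq_order.order_trans[rotated])
  show False
  proof (cases "x = n")
    case False
    have sub: "subseq (x # w) (alternation x n k)"
      by (rule hub_same_ends[OF _ _ _ _ xw]) (use w False in auto)
    have "y \<in> {x, n}"
      using w(2) list_emb_set[OF sub, of y] set_alternation[of x n k] by auto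
    hence "y = n" using xy by simp
    have "subseq (x # w) (alternation x y (k - 1) @ [x])"
      by (rule subseq_alternation_same_ends) (use w xy sub \<open>y = n\<close> in auto)
    thus False using not_w by (simp add: alternation_snoc)
  next
    case True
    hence "y \<noteq> n" using xy by simp
    have sub: "subseq (w @ [y]) (alternation y n k)"
      by (rule hub_same_ends[OF _ _ _ _ wy]) (use w \<open>y \<noteq> n\<close> in auto)
    have "subseq (w @ [y]) (alternation y x (k - 1) @ [y])"
      by (rule subseq_alternation_same_ends) (use w xy sub True in auto)
    thus False using not_w by simp
  qed
qed

text \<open>
  The copy of \<open>u\<close> after an insertion on the left, with \<open>z\<close> in the role of \<open>a\<close> and the hub in that of
  \<open>b\<close>: a hub letter before the block of \<open>z\<close> turns \<open>(zc)\<^sup>k\<close> into \<open>(cz)\<^sup>k c\<close>, whose last letter already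
  belongs to the final run.
\<close>

lemma contains_copy_first_hub:
  assumes "z \<noteq> c" "a \<noteq> b" and v: "set v = {a, b}" "subseq v (alternation b a k)"
    and sub: "subseq (replicate (Suc p) z @ [c] @ alternation z c k @ replicate q c) s"
  shows "contains_copy (replicate (Suc p) a @ v @ replicate (Suc q) b) s"
proof -
  define f where "f = (\<lambda>x. if x = a then z else c)"
  have f: "f a = z" "f b = c" using \<open>a \<noteq> b\<close> by (auto simp: f_def)
  have "subseq (map f v) (alternation c z k)"
    using subseq_map[OF v(2), of f] by (simp add: map_alternation f)
  hence "subseq (replicate (Suc p) z @ map f v @ replicate (Suc q) c)
      (replicate (Suc p) z @ alternation c z k @ replicate (Suc q) c)"
    by (intro list_emb_append_mono) auto
  also have "alternation c z k @ replicate (Suc q) c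
      = [c] @ alternation z c k @ replicate q c"
    using alternation_snoc[of c z k] by (metis append.assoc append_Cons append_Nil replicate_Suc)
  also note sub
  finally have "subseq (map f (replicate (Suc p) a @ v @ replicate (Suc q) b)) s"
    by (simp add: f)
  moreover have "inj_on f (set (replicate (Suc p) a @ v @ replicate (Suc q) b))"
    unfolding set_outer_runs[OF v(1)] using \<open>z \<noteq> c\<close> f by (simp add: inj_on_def)
  ultimately show ?thesis by (rule contains_copyI[rotated])
qed

text \<open>
  The copy of \<open>u\<close> after an insertion on the right, with the roles of \<open>z\<close> and the hub exchanged.
\<close>

lemma contains_copy_last_hub:
  assumes "z \<noteq> c" "a \<noteq> b" and v: "set v = {a, b}" "subseq v (alternation b a k)"
    and sub: "subseq (replicate (Suc p) c @ alternation z c k @ replicate (Suc q) z) s"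
  shows "contains_copy (replicate (Suc p) a @ v @ replicate (Suc q) b) s"
proof -
  define f where "f = (\<lambda>x. if x = a then c else z)"
  have f: "f a = c" "f b = z" using \<open>a \<noteq> b\<close> by (auto simp: f_def)
  have "subseq (map f v) (alternation z c k)"
    using subseq_map[OF v(2), of f] by (simp add: map_alternation f)
  hence "subseq (replicate (Suc p) c @ map f v @ replicate (Suc q) z)
      (replicate (Suc p) c @ alternation z c k @ replicate (Suc q) z)"
    by (intro list_emb_append_mono) auto
  also note sub
  finally have "subseq (map f (replicate (Suc p) a @ v @ replicate (Suc q) b)) s"
    by (simp add: f)
  moreover have "inj_on f (set (replicate (Suc p) a @ v @ replicate (Suc q) b))"
    unfolding set_outer_runs[OF v(1)] using \<open>z \<noteq> c\<close> f by (simp add: inj_on_def)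
  ultimately show ?thesis by (rule contains_copyI[rotated])
qed

text \<open>
  Let the insertion take place in block \<open>t\<close>. A letter \<open>z > t + 1\<close> gets its run of \<open>p + 1\<close> before its
  block, and a letter \<open>z < t\<close> its run of \<open>q + 1\<close> after it. The margin of one block on the left is
  needed for a hub letter between the inserted letter and the block of \<open>z\<close>. Insertions into the sweeps
  are even simpler, and any \<open>t\<close> will do for them.
\<close>

lemma hub_insertion:
  assumes "a \<noteq> b" and v: "set v = {a, b}" "subseq v (alternation b a k)" and k: "k > 0"
    and "n > 0"
    and split: "sweeps p n @ hub n k 0 n @ sweeps q n = xs @ ys"
  shows "\<exists>t. \<forall>z. p < z \<and> z + q < n \<and> z \<noteq> t \<and> z \<noteq> Suc t \<longrightarrow>
           contains_copy (replicate (Suc p) a @ v @ replicate (Suc q) b) (xs @ [z] @ ys)"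
proof -
  let ?u = "replicate (Suc p) a @ v @ replicate (Suc q) b"
  note first = contains_copy_first_hub[OF _ \<open>a \<noteq> b\<close> v]
  note last = contains_copy_last_hub[OF _ \<open>a \<noteq> b\<close> v]
  consider (left) r where "sweeps p n = xs @ r" "ys = r @ hub n k 0 n @ sweeps q n"
    | (middle) r1 r2 where "hub n k 0 n = r1 @ r2" "xs = sweeps p n @ r1" "ys = r2 @ sweeps q n"
    | (right) r where "sweeps q n = r @ ys" "xs = sweeps p n @ hub n k 0 n @ r"
    using split by (auto simp: append_eq_append_conv2)
  thus ?thesis
  proof cases
    case left
    have "contains_copy ?u (xs @ [z] @ ys)" if z: "p < z" "z + q < n" for z
    proof (rule first)
      have "count_list (xs @ r) z = p"
        using z count_sweeps[of p n z] left(1) by simp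
      hence "subseq (replicate (Suc p) z) (xs @ [z] @ r)"
        by (intro subseq_replicate_count) simp
      moreover have "subseq (replicate 1 n @ alternation z n k @ replicate q n) (hub n k 0 n)"
        by (rule subseq_hub_around) (use k z in auto)
      ultimately have "subseq (replicate (Suc p) z @ replicate 1 n @ alternation z n k @ replicate q n)
          ((xs @ [z] @ r) @ hub n k 0 n)"
        by (rule list_emb_append_mono)
      hence "subseq (replicate (Suc p) z @ replicate 1 n @ alternation z n k @ replicate q n)
          (((xs @ [z] @ r) @ hub n k 0 n) @ sweeps q n)"
        by (rule subseq_rev_drop_many)
      thus "subseq (replicate (Suc p) z @ [n] @ alternation z n k @ replicate q n) (xs @ [z] @ ys)"
        by (simp add: left)
    qed (use z in auto)
    thus ?thesis by blast
  next
    case right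
    have "contains_copy ?u (xs @ [z] @ ys)" if z: "p < z" "z + q < n" for z
    proof (rule last)
      have "count_list (r @ ys) z = q"
        using z count_sweeps[of q n z] right(1) by simp
      hence "subseq (replicate (Suc q) z) (r @ [z] @ ys)"
        by (intro subseq_replicate_count) simp
      moreover have "subseq (replicate (Suc p) n @ alternation z n k @ replicate 0 n) (hub n k 0 n)"
        by (rule subseq_hub_around) (use k z in auto)
      ultimately have "subseq ((replicate (Suc p) n @ alternation z n k @ replicate 0 n) @
          replicate (Suc q) z) (hub n k 0 n @ (r @ [z] @ ys))"
        by (intro list_emb_append_mono)
      hence "subseq ((replicate (Suc p) n @ alternation z n k @ replicate 0 n) @
          replicate (Suc q) z) (sweeps p n @ hub n k 0 n @ (r @ [z] @ ys))"
        by (rule subseq_drop_many)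
      thus "subseq (replicate (Suc p) n @ alternation z n k @ replicate (Suc q) z) (xs @ [z] @ ys)"
        by (simp add: right)
    qed (use z in auto)
    thus ?thesis by blast
  next
    case middle
    obtain t r r' where t: "t < n" and
      r: "r1 = hub n k 0 t @ r" "r2 = r' @ hub n k (Suc t) n"
      using concat_map_upt_split[OF middle(1)[unfolded hub_def] \<open>n > 0\<close>]
      unfolding hub_def by metis
    have "contains_copy ?u (xs @ [z] @ ys)"
      if z: "p < z" "z + q < n" "z \<noteq> t" "z \<noteq> Suc t" for z
    proof (cases "z < t")
      case True
      show ?thesis
      proof (rule last)
        have "subseq (replicate (Suc p) n @ alternation z n k @ replicate 0 n) (hub n k 0 t)"
          by (rule subseq_hub_around) (use k z True in auto)
        moreover have "subseq (replicate q z) (sweeps q n)"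
          by (rule subseq_replicate_count) (use z in \<open>simp add: count_sweeps\<close>)
        ultimately have "subseq ((replicate (Suc p) n @ alternation z n k @ replicate 0 n) @
            [] @ [z] @ [] @ replicate q z) (hub n k 0 t @ r @ [z] @ r2 @ sweeps q n)"
          by (intro list_emb_append_mono) auto
        hence "subseq ((replicate (Suc p) n @ alternation z n k @ replicate 0 n) @
            [] @ [z] @ [] @ replicate q z) (sweeps p n @ hub n k 0 t @ r @ [z] @ r2 @ sweeps q n)"
          by (rule subseq_drop_many)
        thus "subseq (replicate (Suc p) n @ alternation z n k @ replicate (Suc q) z)
            (xs @ [z] @ ys)"
          by (simp add: middle r)
      qed (use z in auto)
    next
      case False
      show ?thesis
      proof (rule first)
        have "subseq (replicate 1 n @ alternation z n k @ replicate q n) (hub n k (Suc t) n)"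
          by (rule subseq_hub_around) (use k z False in auto)
        moreover have "subseq (replicate p z) (sweeps p n)"
          by (rule subseq_replicate_count) (use z in \<open>simp add: count_sweeps\<close>)
        ultimately have "subseq (replicate p z @ [] @ [z] @ [] @
            (replicate 1 n @ alternation z n k @ replicate q n))
            (sweeps p n @ r1 @ [z] @ r' @ hub n k (Suc t) n)"
          by (intro list_emb_append_mono) auto
        hence "subseq (replicate p z @ [] @ [z] @ [] @
            (replicate 1 n @ alternation z n k @ replicate q n))
            ((sweeps p n @ r1 @ [z] @ r' @ hub n k (Suc t) n) @ sweeps q n)"
          by (rule subseq_rev_drop_many)
        moreover have "replicate p z @ z # zs = replicate (Suc p) z @ zs" for zs
          by (simp add: replicate_app_Cons_same)
        ultimately show "subseq (replicate (Suc p) z @ [n] @ alternation z n k @ replicate q n)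
            (xs @ [z] @ ys)"
          by (simp add: middle r)
      qed (use z in auto)
    qed
    thus ?thesis by blast
  qed
qed

lemma Sat_linear_hub:
  fixes u :: "'a list"
  assumes u: "u = replicate (Suc p) a @ v @ replicate (Suc q) b" and "a \<noteq> b"
    and v: "v \<noteq> []" "set v = {a, b}" "hd v = b" "last v = a"
  shows "(\<lambda>n. real (Sat u n)) \<in> O(\<lambda>n. real n)"
proof -
  have u2: "card (set u) = 2" 
    using \<open>a \<noteq> b\<close> unfolding u set_outer_runs[OF v(2)] by simp
  define k where "k = (LEAST m. subseq v (alternation b a m))"
  have "subseq v (alternation b a (length v))"
    by (rule subseq_alternation_length) (use v in auto)
  hence vk: "subseq v (alternation b a k)"
    unfolding k_def by (rule LeastI)
  have k: "k > 0" using vk v(1) by (cases k) auto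
  hence min: "\<not> subseq v (alternation b a (k - 1))"
    by (intro not_less_Least[of _ "\<lambda>m. subseq v (alternation b a m)", folded k_def]) simp
  have "\<exists>(A :: nat set) t. finite A \<and> card A = n \<and> set t \<subseteq> A \<and>
      distinct_adj t \<and> \<not> contains_copy u t \<and> length t \<le> (p + 2 * k + q) * n \<and>
      (\<forall>xs ys. t = xs @ ys \<longrightarrow> card {a \<in> A. \<not> contains_copy u (xs @ [a] @ ys)} \<le> p + q + 4)"
    if n': "n \<ge> 3" for n
  proof -
    obtain m where m: "n = Suc m" "m \<ge> 2" using n' by (cases n) auto
    define t where "t = sweeps p m @ hub m k 0 m @ sweeps q m"
    have letters: "set t \<subseteq> {..<n}"
      using set_hub[of m k 0 m] m by (auto simp: t_def sweeps_def)
    have len: "length t \<le> (p + 2 * k + q) * n"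
    proof -
      have "length t = (p + 2 * k + q) * m"
        by (simp add: t_def sweeps_def hub_def length_concat o_def sum_list_triv algebra_simps
            sum_list_replicate)
      thus ?thesis using m by simp
    qed
    have hd_sweeps: "sweeps q m = [] \<or> hd (sweeps q m) = 0"
      using m by (cases q) (auto simp: sweeps_def hd_append)
    have last_sweeps: "sweeps p m = [] \<or> last (sweeps p m) = m - 1"
    proof (cases p)
      case (Suc p')
      hence "sweeps p m = sweeps p' m @ [0..<m]"
        unfolding sweeps_def by (simp flip: replicate_append_same)
      thus ?thesis using m by simp
    qed (simp add: sweeps_def)
    have sparse: "distinct_adj t"
      unfolding t_def using m k distinct_adj_sweeps[of m] distinct_adj_hub[of k m m]
        hd_sweeps last_sweeps hd_hub[of k 0 m m] last_hub[of k 0 m m]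
      by (auto simp: distinct_adj_append_iff hd_append)
    have "card {z \<in> {..<n}. \<not> contains_copy u (xs @ [z] @ ys)} \<le> p + q + 4"
      if split: "t = xs @ ys" for xs ys
    proof -
      obtain i where i: "\<And>z. p < z \<Longrightarrow> z + q < m \<Longrightarrow> z \<noteq> i \<Longrightarrow> z \<noteq> Suc i \<Longrightarrow>
          contains_copy u (xs @ [z] @ ys)"
        using hub_insertion[OF \<open>a \<noteq> b\<close> v(2) vk k _ split[unfolded t_def]] m unfolding u by auto
      have "{z \<in> {..<n}. \<not> contains_copy u (xs @ [z] @ ys)}
              \<subseteq> {..p} \<union> {m - q..<n} \<union> {i, Suc i}"
      proof
        fix z assume z: "z \<in> {z \<in> {..<n}. \<not> contains_copy u (xs @ [z] @ ys)}"
        hence "\<not> (p < z \<and> z + q < m \<and> z \<noteq> i \<and> z \<noteq> Suc i)" using i by blast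
        thus "z \<in> {..p} \<union> {m - q..<n} \<union> {i, Suc i}" using z by auto
      qed
      hence "card {z \<in> {..<n}. \<not> contains_copy u (xs @ [z] @ ys)}
              \<le> card ({..p} \<union> {m - q..<n} \<union> {i, Suc i})"
        by (intro card_mono) auto
      also have "\<dots> \<le> card {..p} + card {m - q..<n} + card {i, Suc i}"
        by (meson add_mono_thms_linordered_semiring(3) card_Un_le order_trans)
      also have "\<dots> \<le> p + q + 4" using m by simp
      finally show ?thesis .
    qed
    thus ?thesis
      using letters len sparse copy_free_hub[OF \<open>a \<noteq> b\<close> v min, of p q m]
      by (intro exI[of _ "{..<n}"] exI[of _ t]) (simp add: u t_def)
  qed
  thus ?thesis by (rule Sat_linear_if_skeletons[OF u2])
qed

section \<open>Words with two runs\<close>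

lemma length_le_count:
  assumes "finite A" "set xs \<subseteq> A" "\<And>x. count_list xs x \<le> m"
  shows "length xs \<le> card A * m"
proof -
  have "length xs = (\<Sum>x\<in>set xs. count_list xs x)" by (simp add: sum_count_set)
  also have "\<dots> \<le> card (set xs) * m"
    using sum_bounded_above[of "set xs" "count_list xs" m] assms(3) by simp
  also have "\<dots> \<le> card A * m" using assms(1,2) by (simp add: card_mono)
  finally show ?thesis .
qed

lemma length_le_filter_neq:
  "distinct_adj xs \<Longrightarrow>
     length xs \<le> 2 * length (filter (\<lambda>y. y \<noteq> x) xs) + (if xs \<noteq> [] \<and> hd xs = x then 1 else 0)"
proof (induction xs)
  case (Cons y xs)
  thus ?case by (cases xs) (auto simp: distinct_adj_Cons split: if_splits)
qed simp

text \<open>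
  Cut \<open>s\<close> after the first prefix in which some letter \<open>x\<close> occurs \<open>p\<close> times. In the prefix every letter
  occurs at most \<open>p\<close> times; after the cut every letter other than \<open>x\<close> occurs
  fewer than \<open>q\<close> times, and by sparsity \<open>x\<close> occurs at most once more often than all the others together.
\<close>

lemma two_runs_free_length:
  fixes s :: "'b list"
  assumes "a \<noteq> b" and free: "\<not> contains_copy (replicate p a @ replicate q b) s"
    and s: "distinct_adj s" "set s \<subseteq> A" "finite A"
  shows "length s \<le> card A * (p + 2 * q) + 2"
proof (cases "\<exists>x. count_list s x \<ge> p")
  case False
  hence "length s \<le> card A * p" by (intro length_le_count s) (meson nat_le_linear)
  thus ?thesis by (simp add: algebra_simps)
next
  case True
  define Q where "Q = (\<lambda>m. \<exists>x. count_list (take m s) x \<ge> p)"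
  define m where "m = (LEAST m. Q m)"
  have "Q (length s)" using True by (simp add: Q_def)
  hence "Q m" unfolding m_def by (rule LeastI)
  then obtain x where x: "count_list (take m s) x \<ge> p" by (auto simp: Q_def)
  have "\<not> Q (m - 1)" if "m > 0"
    by (rule not_less_Least[of _ Q, folded m_def]) (use that in simp)
  hence "count_list (take (m - 1) s) y \<le> p" if "m > 0" for y
    using that by (auto simp: Q_def not_le intro: less_imp_le)
  hence "length (take (m - 1) s) \<le> card A * p" if "m > 0"
    by (intro length_le_count) (use that s set_take_subset[of "m - 1" s] in auto)
  hence prefix: "length (take m s) \<le> card A * p + 1" by (cases m) auto
  define ys where "ys = filter (\<lambda>y. y \<noteq> x) (drop m s)"
  have "count_list ys y \<le> q" for y
  proof (rule ccontr)
    assume "\<not> count_list ys y \<le> q"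
    hence y: "q \<le> count_list ys y" "y \<in> set ys" by (auto simp: count_list_0_iff intro: ccontr)
    hence "y \<noteq> x" by (simp add: ys_def)
    have "subseq (replicate p x @ replicate q y) (take m s @ drop m s)"
    proof (intro list_emb_append_mono)
      show "subseq (replicate q y) (drop m s)"
        using subseq_replicate_count[OF y(1)] subseq_filter_left subseq_order.order_trans
        unfolding ys_def by blast
    qed (rule subseq_replicate_count[OF x])
    hence "subseq (map (\<lambda>z. if z = a then x else y) (replicate p a @ replicate q b)) s"
      using \<open>a \<noteq> b\<close> by simp
    hence "contains_copy (replicate p a @ replicate q b) s"
      by (rule contains_copyI[rotated]) (use \<open>y \<noteq> x\<close> in \<open>auto simp: inj_on_def\<close>)
    thus False using free by simp
  qed
  hence "length ys \<le> card A * q"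
    by (intro length_le_count) (use s set_drop_subset[of m s] in \<open>auto simp: ys_def\<close>)
  moreover have "distinct_adj (drop m s)"
    using s(1) by (metis append_take_drop_id distinct_adj_appendD2)
  hence "length (drop m s) \<le> 2 * length ys + 1"
    using length_le_filter_neq[of "drop m s" x] unfolding ys_def by (auto split: if_splits)
  ultimately have "length (drop m s) \<le> 2 * (card A * q) + 1" by linarith
  moreover have "length s = length (take m s) + length (drop m s)" by simp
  ultimately show ?thesis using prefix by (simp only: algebra_simps)
qed

lemma Sat_linear_two_runs:
  fixes a b :: 'a
  assumes "a \<noteq> b" "p > 0" "q > 0"
  shows "(\<lambda>n. real (Sat (replicate p a @ replicate q b) n)) \<in> O(\<lambda>n. real n)"
proof -
  let ?u = "replicate p a @ replicate q b"
  have u: "card (set ?u) = 2" using assms by simp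
  have "Sat ?u n \<le> (p + 2 * q + 2) * n" if "n \<ge> 1" for n
  proof -
    obtain A :: "nat set" and s where A: "finite A" "card A = n" "saturated ?u A s"
      "length s = Sat ?u n"
      using Sat_attained[OF u] by metis
    have "length s \<le> card A * (p + 2 * q) + 2"
      by (rule two_runs_free_length[OF \<open>a \<noteq> b\<close>]) (use A in \<open>auto simp: saturated_def\<close>)
    also have "\<dots> \<le> (p + 2 * q + 2) * n" using A(2) that by (simp add: algebra_simps)
    finally show ?thesis using A(4) by simp
  qed
  hence "\<forall>\<^sub>F n in sequentially. Sat ?u n \<le> (p + 2 * q + 2) * n"
    unfolding eventually_sequentially by blast
  hence "\<forall>\<^sub>F n in sequentially. norm (real (Sat ?u n)) \<le> real (p + 2 * q + 2) * norm (real n)"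
    by (rule eventually_mono) (metis norm_of_nat of_nat_le_iff of_nat_mult)
  thus ?thesis by (rule bigoI)
qed

section \<open>The linear upper bound and the dichotomy\<close>

text \<open>
  Stripping the first and the last run of \<open>u\<close> leaves either nothing or a word that begins with \<open>b\<close> and
  ends with \<open>a\<close>, because both runs are maximal.
\<close>

lemma outer_runs:
  assumes "set u = {a, b}" "a \<noteq> b" "hd u = a" "last u = b"
  obtains (two_runs) p q where "u = replicate (Suc p) a @ replicate (Suc q) b"
    | (inner) p v q where "u = replicate (Suc p) a @ v @ replicate (Suc q) b"
      "v \<noteq> []" "set v = {a, b}" "hd v = b" "last v = a"
proof -
  define w where "w = dropWhile (\<lambda>x. x = a) u"
  define v where "v = rev (dropWhile (\<lambda>x. x = b) (rev w))"
  define l r where "l = takeWhile (\<lambda>x. x = a) u" and "r = rev (takeWhile (\<lambda>x. x = b) (rev w))"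
  have ul: "u = l @ w" by (simp add: l_def w_def)
  have wr: "w = v @ r" by (metis v_def r_def rev_append rev_rev_ident takeWhile_dropWhile_id)
  have "u \<noteq> []" using assms(1) by auto
  have l: "l = replicate (length l) a" "l \<noteq> []"
  proof -
    show "l = replicate (length l) a"
      by (rule replicate_eqI) (auto simp: l_def dest: set_takeWhileD)
    show "l \<noteq> []" using \<open>u \<noteq> []\<close> assms(3) by (cases u) (auto simp: l_def)
  qed
  have "w \<noteq> []" using assms(1,2) by (auto simp: w_def dropWhile_eq_Nil_conv)
  hence last_w: "last w = b" using ul assms(4) by simp
  have hd_w: "hd w \<noteq> a" using hd_dropWhile[of "\<lambda>x. x = a" u] \<open>w \<noteq> []\<close> by (simp add: w_def)
  have r: "r = replicate (length r) b" "r \<noteq> []"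
  proof -
    show "r = replicate (length r) b"
      by (rule replicate_eqI) (auto simp: r_def dest: set_takeWhileD)
    have "hd (rev w) = b" "rev w \<noteq> []" using last_w \<open>w \<noteq> []\<close> by (simp_all add: hd_rev)
    thus "r \<noteq> []" by (cases "rev w") (auto simp: r_def)
  qed
  obtain p where p: "length l = Suc p" using l(2) by (cases l) auto
  obtain q where q: "length r = Suc q" using r(2) by (cases r) auto
  show thesis
  proof (cases "v = []")
    case True
    thus thesis using two_runs[of p q] ul wr l(1) r(1) p q by simp
  next
    case False
    have "last v \<noteq> b"
      using hd_dropWhile[of "\<lambda>x. x = b" "rev w"] False by (simp add: v_def last_rev)
    moreover have "set v \<subseteq> {a, b}" using assms(1) ul wr by auto
    moreover have "hd v \<noteq> a" using hd_w wr False by simp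
    moreover have "hd v \<in> set v" "last v \<in> set v" using False by auto
    ultimately have "hd v = b" "last v = a" "set v = {a, b}" by blast+
    thus thesis using inner[of p v q] False ul wr l(1) r(1) p q by simp
  qed
qed

lemma Sat_linear:
  fixes u :: "'a list"
  assumes u: "card (set u) = 2"
  shows "(\<lambda>n. real (Sat u n)) \<in> O(\<lambda>n. real n)"
proof (cases "hd u = last u")
  case True
  thus ?thesis by (rule Sat_linear_same_ends[OF u])
next
  case False
  define a b where "a = hd u" and "b = last u"
  have "u \<noteq> []" using u by auto
  hence "{a, b} \<subseteq> set u" by (simp add: a_def b_def)
  moreover have "card {a, b} = 2" using False by (simp add: a_def b_def)
  ultimately have "set u = {a, b}" using u by (metis card_subset_eq finite_set)
  from this False[folded a_def b_def] a_def[symmetric] b_def[symmetric]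
  show ?thesis
  proof (cases rule: outer_runs)
    case (two_runs p q)
    show ?thesis unfolding two_runs
      by (rule Sat_linear_two_runs) (use False in \<open>auto simp: a_def b_def\<close>)
  next
    case (inner p v q)
    show ?thesis
      by (rule Sat_linear_hub[OF inner(1) _ inner(2-)]) (use False in \<open>auto simp: a_def b_def\<close>)
  qed
qed

theorem corollary3p14:
  fixes u :: "'a list"
  assumes "card (set u) = 2"
  shows "(\<lambda>n. real (Sat u n)) \<in> \<Theta>(\<lambda>n. real n) \<or> (\<lambda>n. real (Sat u n)) \<in> O(\<lambda>_. 1)"
proof (cases "\<exists>n. Sat u n < n")
  case True
  thus ?thesis using Sat_bounded_if_small[OF assms] by blast
next
  case False
  hence "(\<lambda>n. real n) \<in> O(\<lambda>n. real (Sat u n))"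
    by (intro bigoI[of _ 1] always_eventually) (auto simp: not_less)
  hence "(\<lambda>n. real (Sat u n)) \<in> \<Omega>(\<lambda>n. real n)"
    by (simp add: bigomega_iff_bigo)
  thus ?thesis using Sat_linear[OF assms] by (auto intro: bigthetaI)
qed

end
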